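(* Let $t\ge 1$ and $r$ be integers with $t<r\le t^2+3t-1$. If $\mathcal H$ is a strictly $t$-intersecting $r$-uniform $r$-partite hypergraph, then $\tau(\mathcal H)\le r-t$.
   Context: All hypergraphs are finite. An $r$-uniform hypergraph $\mathcal H$ is $r$-partite if its vertex set can be partitioned as $V(\mathcal H)=P_1\sqcup\dots\sqcup P_r$ such that $|e\cap P_j|=1$ for every edge $e$ and every $j\in[r]$. It is strictly $t$-intersecting if any two distinct edges share exactly $t$ vertices. A cover of $\mathcal H$ is a set $C\subseteq V(\mathcal H)$ with $C\cap e\neq\emptyset$ for every edge $e$; $\tau(\mathcal H)$ is the minimum size of a cover. *)

theory Defs
  imports Main "HOL-Library.Disjoint_Sets"
begin

text \<open>A hypergraph is given by its vertex set V and its edge set E; there are no multiple edges.\<close>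

definition hypergraph :: "'a set \<Rightarrow> 'a set set \<Rightarrow> bool" where
  "hypergraph V E \<longleftrightarrow> finite V \<and> (\<forall>e\<in>E. e \<subseteq> V)"

definition uniform :: "nat \<Rightarrow> 'a set set \<Rightarrow> bool" where
  "uniform r E \<longleftrightarrow> (\<forall>e\<in>E. card e = r)"

text \<open>The parts are allowed to be empty, which can only happen if there is no edge.\<close>

definition partite :: "nat \<Rightarrow> 'a set \<Rightarrow> 'a set set \<Rightarrow> bool" where
  "partite r V E \<longleftrightarrow>
    (\<exists>P :: nat \<Rightarrow> 'a set. V = (\<Union>j\<in>{1..r}. P j) \<and> disjoint_family_on P {1..r} \<and>
      (\<forall>e\<in>E. \<forall>j\<in>{1..r}. card (e \<inter> P j) = 1))"

definition strictly_intersecting :: "nat \<Rightarrow> 'a set set \<Rightarrow> bool" where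
  "strictly_intersecting t E \<longleftrightarrow> (\<forall>e\<in>E. \<forall>f\<in>E. e \<noteq> f \<longrightarrow> card (e \<inter> f) = t)"

definition is_cover :: "'a set \<Rightarrow> 'a set set \<Rightarrow> 'a set \<Rightarrow> bool" where
  "is_cover V E C \<longleftrightarrow> C \<subseteq> V \<and> (\<forall>e\<in>E. C \<inter> e \<noteq> {})"

text \<open>If no edge is empty, V is itself a cover, so the minimum below is attained.\<close>

definition cover_number :: "'a set \<Rightarrow> 'a set set \<Rightarrow> nat" where
  "cover_number V E = (LEAST n. \<exists>C. is_cover V E C \<and> card C = n)"

end

theory Submission
  imports Defs
begin

text \<open>Suppose that every cover has more than \<open>r - t\<close> vertices. For an edge \<open>e\<close> and a \<open>t\<close>-subset
  \<open>T\<close> of \<open>e\<close> the set \<open>e - T\<close> is too small to be a cover, so some edge \<open>f\<close> has \<open>f \<inter> e = T\<close>. The edges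
  containing \<open>T\<close> form a sunflower with kernel \<open>T\<close>, and an edge meeting \<open>e\<close> as far from \<open>T\<close> as possible
  meets all petals, so there are at most \<open>K + 1\<close> of them, where \<open>K = 1\<close> if \<open>r < 2 t\<close> and
  \<open>K = t + 1\<close> otherwise. With \<open>L = (r - 1 choose (t - 1))\<close>, all degrees \<open>d\<close> of non-isolated vertices thus
  lie in the interval from \<open>L + 1\<close> to \<open>K L + 1\<close>. If there are \<open>m\<close> edges, then the degrees sum to
  \<open>r m\<close> and their squares to \<open>m (r + t (m - 1))\<close>. The non-isolated vertices of a part are a cover, so there are
  at least \<open>r (r - t + 1)\<close> non-isolated vertices. Summing \<open>(d - a) (d - b) \<le> 0\<close> over the latter, for an
  interval from \<open>a\<close> to \<open>b\<close> containing all degrees, gives a quadratic inequality in \<open>m\<close> whose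
  discriminant is negative.\<close>

section \<open>Covers, prescribed traces and sunflowers\<close>

definition degree :: "'a set set \<Rightarrow> 'a \<Rightarrow> nat" where
  "degree E v = card {f \<in> E. v \<in> f}"

lemma card_cover_gt:
  assumes "n < cover_number V E" "is_cover V E C"
  shows "n < card C"
proof -
  have "cover_number V E \<le> card C"
    unfolding cover_number_def using assms(2) by (intro Least_le) blast
  then show ?thesis using assms(1) by simp
qed

lemma hypergraph_finite:
  assumes "hypergraph V E"
  shows "finite E" "e \<in> E \<Longrightarrow> finite e"
proof -
  have V: "finite V" "E \<subseteq> Pow V" using assms unfolding hypergraph_def by auto
  then show "finite E" by (meson finite_Pow_iff finite_subset)
  show "finite e" if "e \<in> E" using that V by (meson PowD finite_subset subsetD)
qed

lemma edge_with_trace: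
  assumes "hypergraph V E" "uniform r E" "strictly_intersecting t E"
    and "t < r" "r - t < cover_number V E"
    and "e \<in> E" "T \<subseteq> e" "card T = t"
  obtains f where "f \<in> E" "f \<noteq> e" "f \<inter> e = T"
proof -
  have fin: "finite e" "finite T"
    using assms hypergraph_finite finite_subset by metis+
  have card_diff: "card (e - T) = r - t"
    using assms fin by (simp add: card_Diff_subset uniform_def)
  have "\<not> is_cover V E (e - T)"
    using card_cover_gt[OF assms(5)] card_diff by fastforce
  moreover have "e - T \<subseteq> V"
    using assms(1,6) unfolding hypergraph_def by auto
  ultimately obtain f where f: "f \<in> E" "(e - T) \<inter> f = {}"
    unfolding is_cover_def by auto
  \<comment> \<open>Here \<open>t < r\<close> matters: \<open>f\<close> misses a nonempty subset of
    \<open>e\<close>, hence differs from \<open>e\<close> and meets it in exactly \<open>t\<close>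
    vertices.\<close>
  have "e - T \<noteq> {}"
    using card_diff assms(4) by (metis card.empty less_irrefl zero_less_diff)
  then have "f \<noteq> e"
    using f(2) by auto
  moreover have "f \<inter> e = T"
  proof (rule card_subset_eq[OF fin(2)])
    show "f \<inter> e \<subseteq> T" using f(2) by auto
    show "card (f \<inter> e) = card T"
      using assms(3,6,8) f(1) \<open>f \<noteq> e\<close> unfolding strictly_intersecting_def by auto
  qed
  ultimately show ?thesis using that f(1) by blast
qed

text \<open>Take \<open>g\<close> with trace \<open>S\<close> on \<open>e\<close>. It meets each
  edge through \<open>T\<close> in \<open>t\<close> vertices, of which
  \<open>card (S \<inter> T)\<close> lie in the kernel \<open>T\<close>. The rest lie in pairwise
  disjoint petals, and all of them have to fit into the \<open>r\<close> vertices of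
  \<open>g\<close>.\<close>

lemma sunflower_bound:
  assumes "hypergraph V E" "uniform r E" "strictly_intersecting t E"
    and "t < r" "r - t < cover_number V E"
    and "e \<in> E" "T \<subseteq> e" "card T = t" "S \<subseteq> e" "card S = t" "S \<noteq> T"
  shows "card {f \<in> E. T \<subseteq> f} * (t - card (S \<inter> T)) + card (S \<inter> T) \<le> r"
proof -
  let ?F = "{f \<in> E. T \<subseteq> f}"
  obtain g where g: "g \<in> E" "g \<noteq> e" "g \<inter> e = S"
    using edge_with_trace[OF assms(1-6) assms(9,10)] by blast
  have fin: "finite E" "finite g" "finite T"
    using assms(1,6,7) g(1) hypergraph_finite[OF assms(1)] finite_subset by blast+
  have finS: "finite S" using g(3) fin(2) by blast
  have gT: "g \<inter> T = S \<inter> T"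
    using g(3) assms(7) by auto
  \<comment> \<open>Otherwise \<open>T\<close> would lie in \<open>S\<close>, and equal sizes would
    give \<open>S = T\<close>. Hence \<open>g\<close> differs from every edge in
    \<open>?F\<close>.\<close>
  have not_sub: "\<not> T \<subseteq> g"
    using gT assms(8,10,11) finS card_subset_eq[of S T] by (metis inf.absorb_iff2 inf.orderI inf_commute)
  have card_petal: "card (f \<inter> g - T) = t - card (S \<inter> T)" if "f \<in> ?F" for f
  proof -
    have "card (f \<inter> g) = t"
      using that g(1) not_sub assms(3) unfolding strictly_intersecting_def by auto
    moreover have "f \<inter> g \<inter> T = S \<inter> T"
      using that gT by auto
    ultimately show ?thesis
      using card_Diff_subset_Int[of "f \<inter> g" T] finS by simp
  qed
  have kernel: "f \<inter> f' = T" if "f \<in> ?F" "f' \<in> ?F" "f \<noteq> f'" for f f'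
  proof -
    have "card (f \<inter> f') = t"
      using that assms(3) unfolding strictly_intersecting_def by auto
    moreover have "finite (f \<inter> f')"
      using that hypergraph_finite[OF assms(1)] by blast
    ultimately show ?thesis
      using card_subset_eq[of "f \<inter> f'" T] that assms(8) by auto
  qed
  have "card (\<Union>f\<in>?F. f \<inter> g - T) = (\<Sum>f\<in>?F. card (f \<inter> g - T))"
  proof (rule card_UN_disjoint)
    show "\<forall>f\<in>?F. \<forall>f'\<in>?F. f \<noteq> f' \<longrightarrow> (f \<inter> g - T) \<inter> (f' \<inter> g - T) = {}"
      using kernel by blast
  qed (use fin in auto)
  also have "\<dots> = card ?F * (t - card (S \<inter> T))"
    using card_petal by simp
  finally have "card ?F * (t - card (S \<inter> T)) + card (S \<inter> T)
      = card ((\<Union>f\<in>?F. f \<inter> g - T) \<union> (S \<inter> T))"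
    using fin finS by (subst card_Un_disjoint) auto
  also have "\<dots> \<le> card g"
    using fin(2) gT by (intro card_mono) auto
  finally show ?thesis
    using assms(2) g(1) by (simp add: uniform_def)
qed

lemma sunflower_bound_large:
  assumes "hypergraph V E" "uniform r E" "strictly_intersecting t E"
    and "t < r" "r - t < cover_number V E"
    and "e \<in> E" "T \<subseteq> e" "card T = t" "1 \<le> t" "2 * t \<le> r"
  shows "card {f \<in> E. T \<subseteq> f} * t \<le> r"
proof -
  have fin: "finite e" "finite T"
    using assms hypergraph_finite finite_subset by metis+
  \<comment> \<open>Since \<open>r\<close> is at least \<open>2 * t\<close>, there is room in
    \<open>e\<close> for an \<open>S\<close> disjoint from \<open>T\<close>.\<close>
  have "t \<le> card (e - T)"
    using assms fin by (simp add: card_Diff_subset uniform_def)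
  then obtain S where S: "S \<subseteq> e - T" "card S = t"
    by (metis obtain_subset_with_card_n)
  then have "S \<inter> T = {}" by auto
  moreover from this have "S \<noteq> T"
    using S assms(9) by auto
  ultimately show ?thesis
    using sunflower_bound[OF assms(1-8), of S] S by auto
qed

lemma sunflower_bound_small:
  assumes "hypergraph V E" "uniform r E" "strictly_intersecting t E"
    and "t < r" "r - t < cover_number V E"
    and "e \<in> E" "T \<subseteq> e" "card T = t" "r < 2 * t"
  shows "card {f \<in> E. T \<subseteq> f} \<le> 2"
proof -
  have fin: "finite e" "finite T"
    using assms hypergraph_finite finite_subset by metis+
  have card_diff: "card (e - T) = r - t"
    using assms fin by (simp add: card_Diff_subset uniform_def)
  \<comment> \<open>Two \<open>t\<close>-subsets of \<open>e\<close> now share at least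
    \<open>2 * t - r\<close> vertices. Adding a set \<open>R\<close> of just that size to
    \<open>e - T\<close> attains this minimum.\<close>
  have "2 * t - r \<le> card T" using assms by simp
  then obtain R where R: "R \<subseteq> T" "card R = 2 * t - r"
    by (metis obtain_subset_with_card_n)
  define S where "S = (e - T) \<union> R"
  have finR: "finite R" using R fin finite_subset by blast
  have ST: "S \<inter> T = R" using R by (auto simp: S_def)
  have "card S = (r - t) + (2 * t - r)"
    unfolding S_def using R fin finR card_diff by (subst card_Un_disjoint) auto
  then have "card S = t" using assms by simp
  moreover have "S \<noteq> T"
    using ST R assms by auto
  moreover have "S \<subseteq> e" using R assms by (auto simp: S_def)
  ultimately have "card {f \<in> E. T \<subseteq> f} * (t - (2 * t - r)) + (2 * t - r) \<le> r"
    using sunflower_bound[OF assms(1-8), of S] ST R by simp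
  moreover have "t - (2 * t - r) = r - t" using assms by simp
  ultimately have "card {f \<in> E. T \<subseteq> f} * (r - t) + (2 * t - r) \<le> r"
    by metis
  then have "card {f \<in> E. T \<subseteq> f} * (r - t) \<le> 2 * (r - t)"
    using assms by linarith
  then show ?thesis using assms(4) by simp
qed

section \<open>Bounds on the degrees\<close>

lemma card_subsets_containing:
  assumes "finite A" "v \<in> A" "1 \<le> t"
  shows "card {T. T \<subseteq> A \<and> card T = t \<and> v \<in> T} = (card A - 1) choose (t - 1)"
proof -
  have "bij_betw (insert v) {B. B \<subseteq> A - {v} \<and> card B = t - 1} {T. T \<subseteq> A \<and> card T = t \<and> v \<in> T}"
  proof (rule bij_betw_byWitness[where f' = "\<lambda>T. T - {v}"])
    show "insert v ` {B. B \<subseteq> A - {v} \<and> card B = t - 1} \<subseteq> {T. T \<subseteq> A \<and> card T = t \<and> v \<in> T}"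
    proof safe
      fix B assume B: "B \<subseteq> A - {v}" "card B = t - 1"
      have "finite B" "v \<notin> B" using B assms(1) finite_subset by blast+
      then show "card (insert v B) = t" using B assms(3) by simp
    qed (use assms in auto)
  qed (use assms in auto)
  then show ?thesis
    using assms n_subsets[of "A - {v}" "t - 1"] by (simp add: bij_betw_same_card[symmetric])
qed

text \<open>The edges through \<open>v\<close> other than \<open>e\<close> are sorted by their trace
  on \<open>e\<close>, a \<open>t\<close>-subset containing \<open>v\<close>. Every such subset
  occurs as a trace, and for at most \<open>K\<close> edges because \<open>e\<close> itself takes
  one place in the sunflower. The final \<open>+ 1\<close> counts \<open>e\<close>.\<close>

lemma degree_bounds:
  assumes "hypergraph V E" "uniform r E" "strictly_intersecting t E"
    and "t < r" "r - t < cover_number V E" "1 \<le> t"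
    and "e \<in> E" "v \<in> e"
    and sunflower: "\<And>T. T \<subseteq> e \<Longrightarrow> card T = t \<Longrightarrow> card {f \<in> E. T \<subseteq> f} \<le> K + 1"
  shows "((r - 1) choose (t - 1)) + 1 \<le> degree E v"
    and "degree E v \<le> K * ((r - 1) choose (t - 1)) + 1"
proof -
  define \<T> where "\<T> = {T. T \<subseteq> e \<and> card T = t \<and> v \<in> T}"
  define F where "F T = {f \<in> E - {e}. f \<inter> e = T}" for T
  have fin: "finite E" "finite e"
    using hypergraph_finite[OF assms(1)] assms(7) by auto
  have fin\<T>: "finite \<T>" unfolding \<T>_def using fin(2) by simp
  have card\<T>: "card \<T> = (r - 1) choose (t - 1)"
    unfolding \<T>_def using card_subsets_containing[OF fin(2) assms(8,6)] assms(2,7)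
    by (simp add: uniform_def)
  have "f \<inter> e \<in> \<T>" if "f \<in> E" "f \<noteq> e" "v \<in> f" for f
    using that assms(3,7,8) unfolding strictly_intersecting_def \<T>_def by simp
  moreover have "v \<in> f" if "f \<in> F T" "T \<in> \<T>" for f T
    using that by (auto simp: F_def \<T>_def)
  ultimately have "{f \<in> E. v \<in> f} = insert e (\<Union>T\<in>\<T>. F T)"
    using assms(7,8) by (intro set_eqI) (auto simp: F_def)
  moreover have "e \<notin> (\<Union>T\<in>\<T>. F T)" "finite (\<Union>T\<in>\<T>. F T)"
    using fin fin\<T> by (auto simp: F_def)
  moreover have "card (\<Union>T\<in>\<T>. F T) = (\<Sum>T\<in>\<T>. card (F T))"
    using fin fin\<T> by (intro card_UN_disjoint) (auto simp: F_def)
  ultimately have deg: "degree E v = (\<Sum>T\<in>\<T>. card (F T)) + 1"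
    unfolding degree_def by simp
  have lower: "1 \<le> card (F T)" if "T \<in> \<T>" for T
  proof -
    have "T \<subseteq> e" "card T = t" using that by (auto simp: \<T>_def)
    then obtain f where "f \<in> E" "f \<noteq> e" "f \<inter> e = T"
      using edge_with_trace[OF assms(1-5,7)] by blast
    then have "f \<in> F T" by (simp add: F_def)
    moreover have "finite (F T)" using fin by (simp add: F_def)
    ultimately show ?thesis
      using card_gt_0_iff[of "F T"] by (auto simp: Suc_le_eq)
  qed
  have upper: "card (F T) \<le> K" if "T \<in> \<T>" for T
  proof -
    have T: "T \<subseteq> e" "card T = t" using that by (auto simp: \<T>_def)
    have "card (insert e (F T)) \<le> card {f \<in> E. T \<subseteq> f}"
      using fin(1) T assms(7) by (intro card_mono) (auto simp: F_def)
    also have "\<dots> \<le> K + 1" by (rule sunflower[OF T])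
    finally show ?thesis using fin by (simp add: F_def)
  qed
  show "((r - 1) choose (t - 1)) + 1 \<le> degree E v"
    using sum_bounded_below[of \<T> 1 "\<lambda>T. card (F T)", OF lower] unfolding deg card\<T> by simp
  show "degree E v \<le> K * ((r - 1) choose (t - 1)) + 1"
    using sum_bounded_above[of \<T> "\<lambda>T. card (F T)" K, OF upper] unfolding deg card\<T>
    by (simp add: mult.commute)
qed

section \<open>Double counting and the quadratic inequality\<close>

lemma sum_degree_on:
  assumes "finite E" "finite A"
  shows "(\<Sum>v\<in>A. degree E v) = (\<Sum>f\<in>E. card (A \<inter> f))"
proof -
  have "(\<Sum>v\<in>A. degree E v) = (\<Sum>v\<in>A. \<Sum>f\<in>E. if v \<in> f then 1 else 0)"
    using assms by (simp add: degree_def sum.If_cases Collect_conj_eq)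
  also have "\<dots> = (\<Sum>f\<in>E. \<Sum>v\<in>A. if v \<in> f then 1 else 0)"
    by (rule sum.swap)
  also have "\<dots> = (\<Sum>f\<in>E. card (A \<inter> f))"
    using assms by (simp add: sum.If_cases)
  finally show ?thesis .
qed

lemma sum_degree_all:
  assumes "hypergraph V E" "uniform r E"
  shows "(\<Sum>v\<in>\<Union>E. degree E v) = card E * r"
proof -
  have "(\<Sum>v\<in>\<Union>E. degree E v) = (\<Sum>f\<in>E. card (\<Union>E \<inter> f))"
    using hypergraph_finite[OF assms(1)] by (intro sum_degree_on) auto
  also have "\<dots> = (\<Sum>f\<in>E. r)"
    using assms(2) by (intro sum.cong) (auto simp: uniform_def Int_absorb1 Union_upper)
  finally show ?thesis by simp
qed

text \<open>Both sides count triples of a vertex and an ordered pair of edges through it: an edge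
  paired with itself contributes \<open>r\<close>, two distinct edges contribute
  \<open>t\<close>.\<close>

lemma sum_degree_square:
  assumes "hypergraph V E" "uniform r E" "strictly_intersecting t E"
  shows "(\<Sum>v\<in>\<Union>E. (degree E v)^2) = card E * (r + (card E - 1) * t)"
proof -
  note fin = hypergraph_finite[OF assms(1)]
  have finU: "finite (\<Union>E)" using fin by auto
  have "(\<Sum>v\<in>\<Union>E. (degree E v)^2) = (\<Sum>v\<in>\<Union>E. \<Sum>e\<in>E. if v \<in> e then degree E v else 0)"
    using fin(1) by (simp add: degree_def sum.If_cases Collect_conj_eq power2_eq_square)
  also have "\<dots> = (\<Sum>e\<in>E. \<Sum>v\<in>\<Union>E. if v \<in> e then degree E v else 0)"
    by (rule sum.swap)
  also have "\<dots> = (\<Sum>e\<in>E. \<Sum>v\<in>e. degree E v)"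
  proof (rule sum.cong)
    fix e assume "e \<in> E"
    then have "\<Union>E \<inter> {v. v \<in> e} = e" by auto
    then show "(\<Sum>v\<in>\<Union>E. if v \<in> e then degree E v else 0) = (\<Sum>v\<in>e. degree E v)"
      using finU by (simp add: sum.If_cases)
  qed simp
  also have "\<dots> = (\<Sum>e\<in>E. r + (card E - 1) * t)"
  proof (rule sum.cong)
    fix e assume e: "e \<in> E"
    have "(\<Sum>v\<in>e. degree E v) = card (e \<inter> e) + (\<Sum>f\<in>E - {e}. card (e \<inter> f))"
      using fin e sum_degree_on[of E e] sum.remove[of E e "\<lambda>f. card (e \<inter> f)"] by simp
    also have "(\<Sum>f\<in>E - {e}. card (e \<inter> f)) = (\<Sum>f\<in>E - {e}. t)"
      using assms(3) e by (intro sum.cong) (auto simp: strictly_intersecting_def)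
    finally show "(\<Sum>v\<in>e. degree E v) = r + (card E - 1) * t"
      using assms(2) e fin by (simp add: uniform_def)
  qed simp
  finally show ?thesis by simp
qed

lemma card_nonisolated_ge:
  assumes "hypergraph V E" "partite r V E" "n < cover_number V E"
  shows "r * (n + 1) \<le> card (\<Union>E)"
proof -
  obtain P :: "nat \<Rightarrow> 'a set" where P: "V = (\<Union>j\<in>{1..r}. P j)" "disjoint_family_on P {1..r}"
    "\<And>e j. e \<in> E \<Longrightarrow> j \<in> {1..r} \<Longrightarrow> card (e \<inter> P j) = 1"
    using assms(2) unfolding partite_def by blast
  have finU: "finite (\<Union>E)"
    using hypergraph_finite[OF assms(1)] by auto
  have part: "n + 1 \<le> card (P j \<inter> \<Union>E)" if j: "j \<in> {1..r}" for j
  proof -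
    have "is_cover V E (P j \<inter> \<Union>E)"
      unfolding is_cover_def
    proof (intro conjI ballI)
      show "P j \<inter> \<Union>E \<subseteq> V" using P(1) j by auto
      fix e assume e: "e \<in> E"
      have "e \<inter> P j \<noteq> {}" using P(3)[OF e j] by auto
      then show "P j \<inter> \<Union>E \<inter> e \<noteq> {}" using e by auto
    qed
    from card_cover_gt[OF assms(3) this] show ?thesis by simp
  qed
  have "r * (n + 1) = (\<Sum>j\<in>{1..r}. n + 1)" by simp
  also have "\<dots> \<le> (\<Sum>j\<in>{1..r}. card (P j \<inter> \<Union>E))"
    by (rule sum_mono[OF part])
  also have "\<dots> = card (\<Union>j\<in>{1..r}. P j \<inter> \<Union>E)"
    using finU P(2) by (intro card_UN_disjoint[symmetric]) (auto simp: disjoint_family_on_def)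
  also have "\<dots> \<le> card (\<Union>E)"
    using finU by (intro card_mono) auto
  finally show ?thesis .
qed

text \<open>The sign condition on \<open>a * b\<close> allows the number of non-isolated vertices,
  which is not known exactly, to be replaced by its lower bound.\<close>

lemma degree_quadratic:
  fixes a b :: int
  assumes "hypergraph V E" "uniform r E" "strictly_intersecting t E" "partite r V E"
    and "t < r" "r - t < cover_number V E"
    and bounds: "\<And>v. v \<in> \<Union>E \<Longrightarrow> a \<le> int (degree E v) \<and> int (degree E v) \<le> b"
    and "0 \<le> a * b"
  shows "int t * (int (card E))\<^sup>2 + (int r - int t) * int (card E) - (a + b) * int r * int (card E)
    + a * b * (int r * (int r - int t + 1)) \<le> 0"
proof -
  let ?m = "int (card E)" and ?d = "\<lambda>v. int (degree E v)"
  have "(\<Sum>v\<in>\<Union>E. ?d v) = ?m * int r"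
    using sum_degree_all[OF assms(1,2)] by (metis of_nat_mult of_nat_sum)
  moreover have "(\<Sum>v\<in>\<Union>E. (?d v)\<^sup>2) = ?m * int r + ?m * (?m - 1) * int t"
  proof -
    have "(\<Sum>v\<in>\<Union>E. (?d v)\<^sup>2) = int (\<Sum>v\<in>\<Union>E. (degree E v)\<^sup>2)"
      by simp
    \<comment> \<open>The case split is for \<open>card E = 0\<close>, where
      \<open>card E - 1\<close> truncates but the factor \<open>card E\<close> vanishes.\<close>
    also have "\<dots> = ?m * int r + ?m * (?m - 1) * int t"
      unfolding sum_degree_square[OF assms(1-3)] by (cases "card E") (simp_all add: algebra_simps)
    finally show ?thesis .
  qed
  moreover have "(\<Sum>v\<in>\<Union>E. (?d v - a) * (?d v - b)) \<le> 0"
    by (intro sum_nonpos mult_nonneg_nonpos) (use bounds in \<open>simp_all only: diff_ge_0_iff_ge diff_le_0_iff_le\<close>)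
  moreover have "(\<Sum>v\<in>\<Union>E. (?d v - a) * (?d v - b))
      = (\<Sum>v\<in>\<Union>E. (?d v)\<^sup>2) - (a + b) * (\<Sum>v\<in>\<Union>E. ?d v) + a * b * int (card (\<Union>E))"
    by (simp add: algebra_simps power2_eq_square sum.distrib sum_subtractf sum_distrib_left)
  moreover have "a * b * (int r * (int r - int t + 1)) \<le> a * b * int (card (\<Union>E))"
  proof (rule mult_left_mono[OF _ assms(8)])
    have "int r * (int r - int t + 1) = int (r * (r - t + 1))"
      using assms(5) by (simp only: of_nat_mult of_nat_add of_nat_1 of_nat_diff less_imp_le)
    also have "\<dots> \<le> int (card (\<Union>E))"
      using card_nonisolated_ge[OF assms(1,4,6)] by (simp only: of_nat_le_iff)
    finally show "int r * (int r - int t + 1) \<le> int (card (\<Union>E))" .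
  qed
  ultimately show ?thesis
    by (simp add: algebra_simps power2_eq_square)
qed

section \<open>Negative discriminants and the contradiction\<close>

lemma quadratic_pos:
  fixes a b c x :: int
  assumes "0 < a" "b\<^sup>2 < 4 * a * c"
  shows "0 < a * x\<^sup>2 - b * x + c"
proof -
  have "4 * a * (a * x\<^sup>2 - b * x + c) = (2 * a * x - b)\<^sup>2 + (4 * a * c - b\<^sup>2)"
    by (simp add: algebra_simps power2_eq_square)
  then have "0 < 4 * a * (a * x\<^sup>2 - b * x + c)"
    using assms(2) by (metis add_nonneg_pos diff_gt_0_iff_gt zero_le_power2)
  then show ?thesis using assms(1) by (simp add: zero_less_mult_iff)
qed

text \<open>The interval is widened to run from \<open>l = L + 1\<close> to \<open>K * l\<close>,
  and the nonnegative term \<open>(r - t) * m\<close> is dropped, with \<open>m\<close> the number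
  of edges. Then \<open>l\<^sup>2 * r\<close> cancels from the discriminant condition, which becomes
  \<open>ratio\<close> and no longer involves the binomial coefficient.\<close>

lemma degree_ratio_contradiction:
  assumes "hypergraph V E" "uniform r E" "strictly_intersecting t E" "partite r V E"
    and "1 \<le> t" "t < r" "r - t < cover_number V E"
    and bounds: "\<And>v. v \<in> \<Union>E \<Longrightarrow> L + 1 \<le> degree E v \<and> degree E v \<le> K * L + 1"
    and "1 \<le> K"
    and ratio: "(int K + 1)\<^sup>2 * int r < 4 * int t * int K * (int r - int t + 1)"
  shows False
proof -
  define l where "l = int L + 1"
  let ?m = "int (card E)" and ?b = "(int K + 1) * l * int r"
    and ?c = "int K * l\<^sup>2 * (int r * (int r - int t + 1))"
  have deg: "l \<le> int (degree E v) \<and> int (degree E v) \<le> int K * l" if "v \<in> \<Union>E" for v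
  proof -
    have "int (degree E v) \<le> int (K * L + 1)" "int (L + 1) \<le> int (degree E v)"
      using bounds[OF that] by (simp_all only: of_nat_le_iff)
    then show ?thesis using assms(9) by (simp add: l_def algebra_simps)
  qed
  have l: "0 < l" by (simp add: l_def)
  have "int t * ?m\<^sup>2 + (int r - int t) * ?m - (l + int K * l) * int r * ?m
    + l * (int K * l) * (int r * (int r - int t + 1)) \<le> 0"
    by (rule degree_quadratic[OF assms(1-4,6,7) deg]) (use l in auto)
  moreover have "0 \<le> (int r - int t) * ?m" using assms(6) by simp
  ultimately have "int t * ?m\<^sup>2 - ?b * ?m + ?c \<le> 0"
    by (simp add: algebra_simps power2_eq_square)
  moreover have "0 < int t * ?m\<^sup>2 - ?b * ?m + ?c"
  proof (rule quadratic_pos)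
    have "(l\<^sup>2 * int r) * ((int K + 1)\<^sup>2 * int r) < (l\<^sup>2 * int r) * (4 * int t * int K * (int r - int t + 1))"
      using l assms(6) by (intro mult_strict_left_mono[OF ratio]) auto
    then show "?b\<^sup>2 < 4 * int t * ?c"
      by (simp add: algebra_simps power2_eq_square)
  qed (use assms(5) in simp)
  ultimately show False by simp
qed

theorem theorem3p6:
  fixes t r :: nat and V :: "'a set" and E :: "'a set set"
  assumes "1 \<le> t" and "t < r" and "r \<le> t^2 + 3 * t - 1"
    and "hypergraph V E"
    and "uniform r E"
    and "partite r V E"
    and "strictly_intersecting t E"
  shows "cover_number V E \<le> r - t"
proof (rule ccontr)
  assume "\<not> cover_number V E \<le> r - t"
  then have \<tau>: "r - t < cover_number V E" by simp
  note hyp = assms(4,5,7,2) \<tau>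
  define L where "L = (r - 1) choose (t - 1)"
  show False
  proof (cases "r < 2 * t")
    case True
    have bounds: "L + 1 \<le> degree E v \<and> degree E v \<le> 1 * L + 1" if v: "v \<in> \<Union>E" for v
    proof -
      obtain e where e: "e \<in> E" "v \<in> e" using v by blast
      have "card {f \<in> E. T \<subseteq> f} \<le> 1 + 1" if "T \<subseteq> e" "card T = t" for T
        using sunflower_bound_small[OF hyp e(1) that True] by simp
      then show ?thesis
        using degree_bounds[OF hyp assms(1) e] unfolding L_def by blast
    qed
    \<comment> \<open>For \<open>K = 1\<close>, four times this product is the slack in
      \<open>ratio\<close>; \<open>t < r < 2 * t\<close> forces \<open>t\<close> to be at least
      2.\<close>
    have "0 < (int t - 1) * (int r - int t)"
      using assms(2) True by (intro mult_pos_pos) auto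
    then have "(int 1 + 1)\<^sup>2 * int r < 4 * int t * int 1 * (int r - int t + 1)"
      by (simp add: algebra_simps)
    then show False
      using degree_ratio_contradiction[OF assms(4,5,7,6,1,2) \<tau> bounds] by simp
  next
    case False
    have sunflower: "card {f \<in> E. T \<subseteq> f} \<le> (t + 1) + 1" if "e \<in> E" "T \<subseteq> e" "card T = t" for e T
    proof -
      have "card {f \<in> E. T \<subseteq> f} * t \<le> r"
        using sunflower_bound_large[OF hyp that assms(1)] False by simp
      \<comment> \<open>The upper bound on \<open>r\<close> is just what keeps a sunflower below
        \<open>t + 3\<close> edges.\<close>
      also have "r < (t + 3) * t"
        using assms(1,3) by (simp add: algebra_simps power2_eq_square)
      finally show ?thesis by simp
    qed
    have bounds: "L + 1 \<le> degree E v \<and> degree E v \<le> (t + 1) * L + 1" if v: "v \<in> \<Union>E" for v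
    proof -
      obtain e where e: "e \<in> E" "v \<in> e" using v by blast
      show ?thesis
        using degree_bounds[OF hyp assms(1) e sunflower[OF e(1)]] unfolding L_def by simp
    qed
    show False
    proof (cases "t = 1")
      case True
      \<comment> \<open>For \<open>t = 1\<close> the condition \<open>ratio\<close> with
        \<open>K = 2\<close> would read \<open>9 * r < 8 * r\<close>. So the exact interval from 2
        to 3 and the linear term are kept, and the two possible values of \<open>r\<close> are
        checked: \<open>m\<^sup>2 - 9 * m + 24\<close> for \<open>r = 2\<close> and
        \<open>m\<^sup>2 - 13 * m + 54\<close> for \<open>r = 3\<close>.\<close>
      have "2 \<le> int (degree E v) \<and> int (degree E v) \<le> 3" if "v \<in> \<Union>E" for v
        using bounds[OF that] True by (simp add: L_def)
      from degree_quadratic[OF assms(4,5,7,6,2) \<tau> this]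
      have quad: "(int (card E))\<^sup>2 + (int r - 1) * int (card E) - 5 * int r * int (card E)
          + 6 * (int r * int r) \<le> 0"
        using True by simp
      have "r = 2 \<or> r = 3" using True assms(2,3) by auto
      then show False
        using quad quadratic_pos[of 1 9 24 "int (card E)"] quadratic_pos[of 1 13 54 "int (card E)"]
        by auto
    next
      case False': False
      \<comment> \<open>The slack in \<open>ratio\<close> for \<open>K = t + 1\<close> is linear in
        \<open>r\<close>. Expanding it at the left end \<open>r = 2 * t\<close> shows a positive
        value and a positive slope once \<open>t\<close> is at least 2.\<close>
      define y where "y = int r - 2 * int t"
      have ty: "2 \<le> int t" "0 \<le> y"
        using False False' assms(1) by (auto simp: y_def)
      have "4 * int t * int (t + 1) * (int r - int t + 1) - (int (t + 1) + 1)\<^sup>2 * int r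
          = (3 * (int t)\<^sup>2 - 4) * y + 2 * int t * ((int t)\<^sup>2 - 2)"
        by (simp add: y_def algebra_simps power2_eq_square)
      moreover have "4 \<le> (int t)\<^sup>2"
        using power_mono[OF ty(1), of 2] by simp
      then have "0 \<le> (3 * (int t)\<^sup>2 - 4) * y" "0 < 2 * int t * ((int t)\<^sup>2 - 2)"
        using ty by auto
      ultimately have "(int (t + 1) + 1)\<^sup>2 * int r < 4 * int t * int (t + 1) * (int r - int t + 1)"
        by linarith
      then show False
        using degree_ratio_contradiction[OF assms(4,5,7,6,1,2) \<tau> bounds] by simp
    qed
  qed
qed

end
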